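(* Let $G=(V,E)$ be an undirected graph that admits a nowhere-zero circular $k$-flow for some rational $k\ge2$, and let $\tau$ be a positive integer. Then every nowhere-zero $\tau$-SCD $w$ of $\vec G$ can pack $\lfloor\tau/(k+1)\rfloor$ strongly connected digraphs; i.e., there exist $m=\lfloor\tau/(k+1)\rfloor$ arc sets $F_1,\dots,F_m\subseteq E^+\cup E^-$, each with $\delta^+_{\vec G}(U)\cap F_i\neq\emptyset$ for all $\emptyset\neq U\subsetneq V$, such that every arc $a$ of $\vec G$ lies in at most $w_a$ of the $F_i$.
   Context: Graphs are finite and loopless; parallel edges allowed. For an undirected graph $G=(V,E)$, $\vec G=(V,E^+\cup E^-)$ is obtained by replacing each edge $e=\{u,v\}$ by arcs $e^+=(u,v)$ and $e^-=(v,u)$ (choice arbitrary); $\delta^+_{\vec G}(U)$ is the set of arcs of $\vec G$ leaving $U$, and $w(B)=\sum_{e\in B}w_e$. A nowhere-zero $\tau$-SCD of $\vec G$ is an integral vector $w\in\mathbb{Z}^{E^+\cup E^-}$ with $w_{e^+}\ge1$, $w_{e^-}\ge1$ for all $e\in E$ and $w(\delta^+_{\vec G}(U))\ge\tau$ for all $\emptyset\neq U\subsetneq V$. For rational $k\ge2$, a nowhere-zero circular $k$-flow of $G$ is a pair $(E',f)$ with $E'$ an orientation of $G$ and $f:E'\to[1,k-1]$ real-valued satisfying flow conservation at every vertex. *)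

theory Defs
  imports Complex_Main
begin

text \<open>An undirected loopless multigraph: finite vertex set V, finite edge index set E,
  each edge e has two distinct endpoints ea e, eb e in V (parallel edges allowed).
  The bidirected graph has arcs (e, True) = e^+ = (ea e, eb e) and
  (e, False) = e^- = (eb e, ea e).\<close>

definition graph :: "'v set \<Rightarrow> 'e set \<Rightarrow> ('e \<Rightarrow> 'v) \<Rightarrow> ('e \<Rightarrow> 'v) \<Rightarrow> bool" where
  "graph V E ea eb \<longleftrightarrow> finite V \<and> finite E \<and>
     (\<forall>e\<in>E. ea e \<in> V \<and> eb e \<in> V \<and> ea e \<noteq> eb e)"

definition arcs :: "'e set \<Rightarrow> ('e \<times> bool) set" where
  "arcs E = E \<times> (UNIV :: bool set)"

definition arc_tail :: "('e \<Rightarrow> 'v) \<Rightarrow> ('e \<Rightarrow> 'v) \<Rightarrow> 'e \<times> bool \<Rightarrow> 'v" where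
  "arc_tail ea eb a = (if snd a then ea (fst a) else eb (fst a))"

definition arc_head :: "('e \<Rightarrow> 'v) \<Rightarrow> ('e \<Rightarrow> 'v) \<Rightarrow> 'e \<times> bool \<Rightarrow> 'v" where
  "arc_head ea eb a = (if snd a then eb (fst a) else ea (fst a))"

definition dout :: "'e set \<Rightarrow> ('e \<Rightarrow> 'v) \<Rightarrow> ('e \<Rightarrow> 'v) \<Rightarrow> 'v set \<Rightarrow> ('e \<times> bool) set" where
  "dout E ea eb U = {a \<in> arcs E. arc_tail ea eb a \<in> U \<and> arc_head ea eb a \<notin> U}"

definition nz_scd :: "'v set \<Rightarrow> 'e set \<Rightarrow> ('e \<Rightarrow> 'v) \<Rightarrow> ('e \<Rightarrow> 'v) \<Rightarrow> int \<Rightarrow> ('e \<times> bool \<Rightarrow> int) \<Rightarrow> bool" where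
  "nz_scd V E ea eb \<tau> w \<longleftrightarrow>
     (\<forall>e\<in>E. w (e, True) \<ge> 1 \<and> w (e, False) \<ge> 1) \<and>
     (\<forall>U. U \<noteq> {} \<and> U \<subset> V \<longrightarrow> sum w (dout E ea eb U) \<ge> \<tau>)"

definition nz_circ_flow :: "'v set \<Rightarrow> 'e set \<Rightarrow> ('e \<Rightarrow> 'v) \<Rightarrow> ('e \<Rightarrow> 'v) \<Rightarrow> real \<Rightarrow>
    ('e \<Rightarrow> bool) \<Rightarrow> ('e \<Rightarrow> real) \<Rightarrow> bool" where
  "nz_circ_flow V E ea eb k ori f \<longleftrightarrow>
     (\<forall>e\<in>E. 1 \<le> f e \<and> f e \<le> k - 1) \<and>
     (\<forall>v\<in>V. (\<Sum>e\<in>{e\<in>E. arc_tail ea eb (e, ori e) = v}. f e)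
            = (\<Sum>e\<in>{e\<in>E. arc_head ea eb (e, ori e) = v}. f e))"

definition has_nz_circ_flow :: "'v set \<Rightarrow> 'e set \<Rightarrow> ('e \<Rightarrow> 'v) \<Rightarrow> ('e \<Rightarrow> 'v) \<Rightarrow> real \<Rightarrow> bool" where
  "has_nz_circ_flow V E ea eb k \<longleftrightarrow> (\<exists>ori f. nz_circ_flow V E ea eb k ori f)"

end

theory Submission
  imports Defs
begin

text \<open>Let \<open>f\<close> be a circular \<open>k\<close>-flow on an orientation of \<open>G\<close>. Flow conservation across a cut shows that
  the numbers of forward and of backward edges in the cut differ at most by the factor \<open>k - 1\<close>.
  Split \<open>w = x + y\<close> by halving every \<open>w\<^sub>a\<close>, where \<open>x\<close> rounds up on the forward arcs and down on the
  backward arcs, and \<open>y\<close> the other way round. Since \<open>w \<ge> 1\<close>, the balance of the cuts makes both \<open>x\<close>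
  and \<open>y\<close> cover every cut at least \<open>\<tau> / (k + 1)\<close> times. By Edmonds' disjoint branching theorem \<open>x\<close>
  packs \<open>\<lfloor>\<tau> / (k + 1)\<rfloor>\<close> spanning out-branchings of a fixed root and \<open>y\<close> packs as many in-branchings.
  The union of an out-branching and an in-branching is strongly connected.\<close>

section \<open>Edmonds' disjoint branchings\<close>

definition entering :: "'a set \<Rightarrow> ('a \<Rightarrow> 'v) \<Rightarrow> ('a \<Rightarrow> 'v) \<Rightarrow> 'v set \<Rightarrow> 'a set" where
  "entering A t h X = {a \<in> A. t a \<notin> X \<and> h a \<in> X}"

lemma finite_entering [simp]: "finite A \<Longrightarrow> finite (entering A t h X)"
  by (simp add: entering_def)

lemma sum_entering:
  assumes "finite A"
  shows "sum g (entering A t h X) = (\<Sum>a\<in>A. if t a \<notin> X \<and> h a \<in> X then g a else 0)"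
  unfolding entering_def using assms by (simp add: sum.inter_filter)

text \<open>Holds arc by arc: only arcs between \<open>X - Y\<close> and \<open>Y - X\<close>
  contribute to the right-hand side alone.\<close>

lemma sum_entering_submodular:
  fixes g :: "'a \<Rightarrow> int"
  assumes "finite A" "\<And>a. a \<in> A \<Longrightarrow> 0 \<le> g a"
  shows "sum g (entering A t h (X \<inter> Y)) + sum g (entering A t h (X \<union> Y))
       \<le> sum g (entering A t h X) + sum g (entering A t h Y)"
  unfolding sum_entering[OF assms(1)] sum.distrib[symmetric]
  by (rule sum_mono) (use assms(2) in auto)

text \<open>Lovasz's proof of Edmonds' theorem: a branching on the vertex set \<open>T\<close> grows by one arc that enters no
  tight set. Such an arc is found inside a minimal set \<open>X\<close> not contained in \<open>T\<close> that is tight or all of \<open>V\<close>.\<close>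

definition partial_branching ::
    "'v set \<Rightarrow> 'a set \<Rightarrow> ('a \<Rightarrow> 'v) \<Rightarrow> ('a \<Rightarrow> 'v) \<Rightarrow> 'v \<Rightarrow> int \<Rightarrow> ('a \<Rightarrow> int) \<Rightarrow> 'v set \<Rightarrow> 'a set \<Rightarrow> bool" where
  "partial_branching V A t h r m c T F \<longleftrightarrow>
     r \<in> T \<and> T \<subseteq> V \<and> F \<subseteq> A \<and> (\<forall>a\<in>F. t a \<in> T \<and> h a \<in> T \<and> 1 \<le> c a) \<and>
     (\<forall>X. X \<subseteq> V - {r} \<and> X \<inter> T \<noteq> {} \<longrightarrow> entering A t h X \<inter> F \<noteq> {}) \<and>
     (\<forall>X. X \<subseteq> V - {r} \<and> X \<noteq> {} \<longrightarrow> m \<le> (\<Sum>a\<in>entering A t h X. c a - of_bool (a \<in> F)))"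

text \<open>In \<open>partial_branching\<close>, the condition on
  \<open>entering A t h X \<inter> F\<close> is the cut form of reachability of \<open>T\<close>
  from \<open>r\<close> inside \<open>F\<close>. The last conjunct reserves capacity for
  \<open>m\<close> further branchings.\<close>

lemma partial_branching_extend:
  fixes c :: "'a \<Rightarrow> int"
  assumes fin: "finite V" "finite A"
    and ends: "\<And>a. a \<in> A \<Longrightarrow> t a \<in> V \<and> h a \<in> V"
    and nonneg: "\<And>a. a \<in> A \<Longrightarrow> 0 \<le> c a"
    and m: "0 \<le> m"
    and cut: "\<And>X. X \<subseteq> V - {r} \<Longrightarrow> X \<noteq> {} \<Longrightarrow> m + 1 \<le> sum c (entering A t h X)"
    and pb: "partial_branching V A t h r m c T F" and "T \<noteq> V"
  shows "\<exists>v F'. v \<in> V - T \<and> partial_branching V A t h r m c (insert v T) F'"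
proof -
  define d where "d a = c a - of_bool (a \<in> F)" for a
  let ?D = "\<lambda>X. sum d (entering A t h X)"
  note pb = pb[unfolded partial_branching_def, folded d_def]
  have T: "r \<in> T" "T \<subseteq> V" and F: "F \<subseteq> A"
    using pb by simp_all
  have Fe: "t a \<in> T \<and> h a \<in> T \<and> 1 \<le> c a" if "a \<in> F" for a
    using pb that by simp
  have reach: "entering A t h X \<inter> F \<noteq> {}" if "X \<subseteq> V - {r}" "X \<inter> T \<noteq> {}" for X
    using pb that by simp
  have res: "m \<le> ?D X" if "X \<subseteq> V - {r}" "X \<noteq> {}" for X
    using pb that by simp
  have d0: "0 \<le> d a" if "a \<in> A" for a
    using nonneg[OF that] Fe[of a] by (auto simp: d_def)
  define tight where "tight X \<longleftrightarrow> X \<subseteq> V - {r} \<and> X \<noteq> {} \<and> ?D X = m" for X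
  define Q where "Q X \<longleftrightarrow> (X = V \<or> tight X) \<and> \<not> X \<subseteq> T" for X
  \<comment> \<open>Admitting \<open>V\<close> as a candidate guarantees a minimal one even when
    every tight set lies inside \<open>T\<close>.\<close>
  have "Q V" using T \<open>T \<noteq> V\<close> by (auto simp: Q_def)
  then obtain X where X: "Q X" and min: "\<And>Y. Q Y \<Longrightarrow> card X \<le> card Y"
    using ex_has_least_nat[of Q V card] by blast
  have XV: "X \<subseteq> V" using X by (auto simp: Q_def tight_def)
  have Z: "X - T \<subseteq> V - {r}" "X - T \<noteq> {}" using X XV T by (auto simp: Q_def)
  \<comment> \<open>Arcs of \<open>F\<close> have their heads in \<open>T\<close>, so no capacity
    entering \<open>X - T\<close> is spent and the surplus of one unit over \<open>m\<close> is
    intact.\<close>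
  have "d a = c a" if "a \<in> entering A t h (X - T)" for a
    using that Fe[of a] by (auto simp: d_def entering_def)
  then have DZ: "m + 1 \<le> ?D (X - T)"
    using cut[OF Z] by (metis (no_types, lifting) sum.cong)
  \<comment> \<open>Otherwise all residual capacity entering \<open>X - T\<close> would come from
    outside \<open>X\<close>, hence be at most \<open>?D X \<le> m\<close>.\<close>
  obtain a where a: "a \<in> A" "t a \<in> X \<inter> T" "h a \<in> X - T" "1 \<le> d a"
  proof (rule ccontr)
    assume "\<not> thesis"
    then have none: "\<And>a. a \<in> A \<Longrightarrow> t a \<in> X \<inter> T \<Longrightarrow> h a \<in> X - T \<Longrightarrow> d a \<le> 0"
      using that by force
    have "?D (X - T) \<le> ?D X"
      unfolding sum_entering[OF fin(2)]
      by (rule sum_mono) (use none d0 in auto)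
    moreover have "?D X \<le> m"
    proof (cases "X = V")
      case True
      then have "entering A t h X = {}" using ends by (auto simp: entering_def)
      then show ?thesis using m by simp
    next
      case False
      then show ?thesis using X by (auto simp: Q_def tight_def)
    qed
    ultimately show False using DZ by simp
  qed
  \<comment> \<open>Uncrossing: if \<open>a\<close> entered a tight \<open>Y\<close>, its tail would
    lie in \<open>X - Y\<close> and its head in \<open>X \<inter> Y\<close> outside
    \<open>T\<close>, making \<open>X \<inter> Y\<close> a smaller candidate than
    \<open>X\<close>.\<close>
  have notight: "a \<notin> entering A t h Y" if Y: "tight Y" for Y
  proof
    assume aY: "a \<in> entering A t h Y"
    have "tight (X \<inter> Y)"
    proof (cases "X = V")
      case True
      then have "X \<inter> Y = Y" using Y by (auto simp: tight_def)
      then show ?thesis using Y by simp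
    next
      case False
      then have X': "tight X" using X by (auto simp: Q_def)
      have I: "X \<inter> Y \<subseteq> V - {r}" "X \<inter> Y \<noteq> {}" and U: "X \<union> Y \<subseteq> V - {r}" "X \<union> Y \<noteq> {}"
        using X' Y a aY by (auto simp: tight_def entering_def)
      \<comment> \<open>Both terms on the left are at least \<open>m\<close> and the right-hand side
        is \<open>2 * m\<close>, so equality holds throughout.\<close>
      have "?D (X \<inter> Y) + ?D (X \<union> Y) \<le> ?D X + ?D Y"
        using sum_entering_submodular[OF fin(2)] d0 by blast
      with res[OF I] res[OF U] X' Y have "?D (X \<inter> Y) = m"
        by (simp add: tight_def)
      with I show ?thesis by (simp add: tight_def)
    qed
    moreover have "\<not> X \<inter> Y \<subseteq> T" using a aY by (auto simp: entering_def)
    ultimately have "card X \<le> card (X \<inter> Y)" using min by (simp add: Q_def)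
    moreover have "X \<inter> Y \<subset> X" using a aY by (auto simp: entering_def)
    ultimately show False
      using psubset_card_mono[of X "X \<inter> Y"] finite_subset[OF XV fin(1)] by simp
  qed
  have aF: "a \<notin> F" using a Fe by auto
  let ?F = "insert a F"
  have "m \<le> (\<Sum>b\<in>entering A t h Y. c b - of_bool (b \<in> ?F))" if Y: "Y \<subseteq> V - {r}" "Y \<noteq> {}" for Y
  proof -
    have "(\<Sum>b\<in>entering A t h Y. c b - of_bool (b \<in> ?F))
        = (\<Sum>b\<in>entering A t h Y. d b - of_bool (b = a))"
      by (rule sum.cong) (use aF in \<open>auto simp: d_def\<close>)
    also have "\<dots> = ?D Y - of_bool (a \<in> entering A t h Y)"
      using fin(2) by (simp add: sum_subtractf of_bool_def)
    finally show ?thesis using res[OF Y] notight[of Y] Y by (auto simp: tight_def)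
  qed
  \<comment> \<open>A set that contains \<open>h a\<close> but misses \<open>T\<close> is entered by
    \<open>a\<close> itself, whose tail is in \<open>T\<close>.\<close>
  moreover have "entering A t h Y \<inter> ?F \<noteq> {}" if Y: "Y \<subseteq> V - {r}" "Y \<inter> insert (h a) T \<noteq> {}" for Y
  proof (cases "Y \<inter> T = {}")
    case True
    then have "a \<in> entering A t h Y" using Y a by (auto simp: entering_def)
    then show ?thesis by auto
  qed (use reach[OF Y(1)] in auto)
  moreover have "1 \<le> c a" using a aF by (simp add: d_def)
  ultimately have "partial_branching V A t h r m c (insert (h a) T) ?F"
    unfolding partial_branching_def using T F Fe a ends by auto
  then show ?thesis using a XV by blast
qed

text \<open>Iterates the one-arc extension from the single vertex \<open>r\<close>; the finite set
  \<open>V - T\<close> shrinks each time.\<close>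

lemma spanning_branching:
  fixes c :: "'a \<Rightarrow> int"
  assumes fin: "finite V" "finite A" and r: "r \<in> V"
    and ends: "\<And>a. a \<in> A \<Longrightarrow> t a \<in> V \<and> h a \<in> V"
    and nonneg: "\<And>a. a \<in> A \<Longrightarrow> 0 \<le> c a"
    and m: "0 \<le> m"
    and cut: "\<And>X. X \<subseteq> V - {r} \<Longrightarrow> X \<noteq> {} \<Longrightarrow> m + 1 \<le> sum c (entering A t h X)"
  shows "\<exists>F. partial_branching V A t h r m c V F"
proof -
  have "\<exists>F. partial_branching V A t h r m c V F" if "partial_branching V A t h r m c T F" for T F
    using that
  proof (induction "card (V - T)" arbitrary: T F rule: less_induct)
    case less
    show ?case
    proof (cases "T = V")
      case False
      then obtain v F' where v: "v \<in> V - T" "partial_branching V A t h r m c (insert v T) F'"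
        using partial_branching_extend[OF fin ends nonneg m cut less.prems] by blast
      have "V - insert v T \<subset> V - T" using v by auto
      then show ?thesis using less.hyps[OF psubset_card_mono v(2)] fin by simp
    qed (use less.prems in auto)
  qed
  moreover have "m \<le> sum c (entering A t h X)" if "X \<subseteq> V - {r}" "X \<noteq> {}" for X
    using cut[OF that] by simp
  then have "partial_branching V A t h r m c {r} {}"
    using r by (auto simp: partial_branching_def)
  ultimately show ?thesis by blast
qed

text \<open>Induction on \<open>m\<close>: removing one spanning branching \<open>B\<close> from the
  capacities preserves the cut condition for the remaining ones. Capacities play the role of
  parallel arcs.\<close>

theorem edmonds_branchings:
  fixes c :: "'a \<Rightarrow> int"
  assumes fin: "finite V" "finite A" and r: "r \<in> V"
    and ends: "\<And>a. a \<in> A \<Longrightarrow> t a \<in> V \<and> h a \<in> V"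
    and nonneg: "\<And>a. a \<in> A \<Longrightarrow> 0 \<le> c a"
    and cut: "\<And>X. X \<subseteq> V - {r} \<Longrightarrow> X \<noteq> {} \<Longrightarrow> int m \<le> sum c (entering A t h X)"
  shows "\<exists>F :: nat \<Rightarrow> 'a set.
     (\<forall>i<m. F i \<subseteq> A \<and> (\<forall>X. X \<subseteq> V - {r} \<and> X \<noteq> {} \<longrightarrow> entering A t h X \<inter> F i \<noteq> {})) \<and>
     (\<forall>a\<in>A. int (card {i. i < m \<and> a \<in> F i}) \<le> c a)"
  using nonneg cut
proof (induction m arbitrary: c)
  case 0
  then show ?case by simp
next
  case (Suc m)
  have "int m + 1 \<le> sum c (entering A t h X)" if "X \<subseteq> V - {r}" "X \<noteq> {}" for X
    using Suc.prems(2)[OF that] by simp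
  from spanning_branching[OF fin r ends Suc.prems(1) _ this] obtain B where B: "B \<subseteq> A" "\<And>a. a \<in> B \<Longrightarrow> 1 \<le> c a"
      "\<And>X. X \<subseteq> V - {r} \<Longrightarrow> X \<noteq> {} \<Longrightarrow> entering A t h X \<inter> B \<noteq> {}"
      "\<And>X. X \<subseteq> V - {r} \<Longrightarrow> X \<noteq> {} \<Longrightarrow> int m \<le> (\<Sum>a\<in>entering A t h X. c a - of_bool (a \<in> B))"
    unfolding partial_branching_def by (auto simp: Int_absorb2 subset_Diff_insert)
  have "0 \<le> c a - of_bool (a \<in> B)" if "a \<in> A" for a
    using Suc.prems(1)[OF that] B(2)[of a] by auto
  from Suc.IH[OF this B(4)] obtain F where
    F: "\<forall>i<m. F i \<subseteq> A \<and> (\<forall>X. X \<subseteq> V - {r} \<and> X \<noteq> {} \<longrightarrow> entering A t h X \<inter> F i \<noteq> {})"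
      "\<forall>a\<in>A. int (card {i. i < m \<and> a \<in> F i}) \<le> c a - of_bool (a \<in> B)"
    by auto
  have "int (card {i. i < Suc m \<and> a \<in> (F(m := B)) i}) \<le> c a" if "a \<in> A" for a
  proof -
    have "{i. i < Suc m \<and> a \<in> (F(m := B)) i} = {i. i < m \<and> a \<in> F i} \<union> (if a \<in> B then {m} else {})"
      by (auto simp: less_Suc_eq)
    then show ?thesis using F(2) that by auto
  qed
  moreover have "(F(m := B)) i \<subseteq> A \<and>
      (\<forall>X. X \<subseteq> V - {r} \<and> X \<noteq> {} \<longrightarrow> entering A t h X \<inter> (F(m := B)) i \<noteq> {})" if "i < Suc m" for i
    using F(1) B that by (cases "i = m") auto
  ultimately show ?case by blast
qed

section \<open>Rounding halves along a flow\<close>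

text \<open>Exchanging heads and tails lets Edmonds' theorem also produce in-branchings.\<close>

lemma dout_conv_entering: "dout E ea eb U = entering (arcs E) (arc_head ea eb) (arc_tail ea eb) U"
  by (auto simp: dout_def entering_def)

text \<open>Summing conservation over \<open>U\<close>, edges with both ends in \<open>U\<close>
  cancel.\<close>

lemma flow_conservation_cut:
  fixes f :: "'e \<Rightarrow> real"
  assumes "finite U" "finite E"
    and cons: "\<And>v. v \<in> U \<Longrightarrow> sum f {e\<in>E. t e = v} = sum f {e\<in>E. h e = v}"
  shows "sum f {e\<in>E. t e \<in> U \<and> h e \<notin> U} = sum f {e\<in>E. h e \<in> U \<and> t e \<notin> U}"
proof -
  have group: "sum f {e\<in>E. g e \<in> U} = (\<Sum>v\<in>U. sum f {e\<in>E. g e = v})" for g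
  proof -
    have "(\<Sum>v\<in>U. sum f {e \<in> {e\<in>E. g e \<in> U}. g e = v}) = sum f {e\<in>E. g e \<in> U}"
      by (rule sum.group) (use assms in auto)
    moreover have "{e \<in> {e\<in>E. g e \<in> U}. g e = v} = {e\<in>E. g e = v}" if "v \<in> U" for v
      using that by auto
    ultimately show ?thesis by simp
  qed
  have split: "sum f {e\<in>E. p e \<in> U} = sum f {e\<in>E. p e \<in> U \<and> q e \<notin> U} + sum f {e\<in>E. p e \<in> U \<and> q e \<in> U}"
    for p q :: "'e \<Rightarrow> _"
    by (subst sum.union_disjoint[symmetric]) (use assms in \<open>auto intro!: sum.cong\<close>)
  have "sum f {e\<in>E. t e \<in> U} = sum f {e\<in>E. h e \<in> U}"
    unfolding group using cons by simp
  then show ?thesis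
    using split[of t h] split[of h t] by (simp add: conj_commute)
qed

text \<open>With equal flow \<open>f\<close> in both directions of the cut and values in
  \<open>[1, k - 1]\<close>, the size of one side is at most its flow, which is at most
  \<open>k - 1\<close> times the size of the other.\<close>

lemma dout_balanced:
  assumes G: "graph V E ea eb" and flow: "nz_circ_flow V E ea eb k ori f" and "U \<subseteq> V"
  defines "A \<equiv> {a \<in> dout E ea eb U. snd a = ori (fst a)}"
    and "B \<equiv> {a \<in> dout E ea eb U. snd a \<noteq> ori (fst a)}"
  shows "real (card A) \<le> (k - 1) * real (card B)" "real (card B) \<le> (k - 1) * real (card A)"
proof -
  let ?t = "\<lambda>e. arc_tail ea eb (e, ori e)" and ?h = "\<lambda>e. arc_head ea eb (e, ori e)"
  let ?A = "{e\<in>E. ?t e \<in> U \<and> ?h e \<notin> U}" and ?B = "{e\<in>E. ?h e \<in> U \<and> ?t e \<notin> U}"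
  have "finite E" and "finite U"
    using G \<open>U \<subseteq> V\<close> by (auto simp: graph_def finite_subset)
  have f: "\<And>e. e \<in> E \<Longrightarrow> 1 \<le> f e \<and> f e \<le> k - 1"
    using flow by (simp add: nz_circ_flow_def)
  have eq: "sum f ?A = sum f ?B"
    by (rule flow_conservation_cut[OF \<open>finite U\<close> \<open>finite E\<close>])
      (use flow \<open>U \<subseteq> V\<close> in \<open>auto simp: nz_circ_flow_def\<close>)
  have "bij_betw fst A ?A"
    by (rule bij_betw_byWitness[where f' = "\<lambda>e. (e, ori e)"])
      (auto simp: A_def dout_def arcs_def arc_tail_def arc_head_def)
  then have A: "card A = card ?A" by (rule bij_betw_same_card)
  \<comment> \<open>A backward arc leaves \<open>U\<close> exactly when its edge is oriented into
    \<open>U\<close>, hence the flipped witness.\<close>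
  have "bij_betw fst B ?B"
    by (rule bij_betw_byWitness[where f' = "\<lambda>e. (e, \<not> ori e)"])
      (auto simp: B_def dout_def arcs_def arc_tail_def arc_head_def split: if_splits)
  then have B: "card B = card ?B" by (rule bij_betw_same_card)
  have lower: "real (card S) \<le> sum f S" and upper: "sum f S \<le> (k - 1) * real (card S)"
    if "S \<subseteq> E" for S
    using that f sum_bounded_below[of S 1 f] sum_bounded_above[of S f "k - 1"]
    by (auto simp: mult.commute)
  show "real (card A) \<le> (k - 1) * real (card B)"
    using lower[of ?A] upper[of ?B] eq unfolding A B by simp
  show "real (card B) \<le> (k - 1) * real (card A)"
    using lower[of ?B] upper[of ?A] eq unfolding A B by simp
qed

text \<open>The worst case is \<open>w = 2\<close> on \<open>A\<close> and \<open>w = 1\<close> on \<open>B\<close>, which is where \<open>k + 1\<close> comes from.\<close>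

lemma rounded_halves_ge:
  fixes w :: "'a \<Rightarrow> int" and k :: real
  assumes "finite D" and k: "2 \<le> k" and w: "\<And>a. a \<in> D \<Longrightarrow> 1 \<le> w a"
    and bal: "real (card {a\<in>D. \<not> P a}) \<le> (k - 1) * real (card {a\<in>D. P a})"
  shows "real_of_int (sum w D) \<le> (k + 1) * real_of_int (\<Sum>a\<in>D. if P a then (w a + 1) div 2 else w a div 2)"
proof -
  have up: "real_of_int (w a) + (k - 1) \<le> (k + 1) * real_of_int ((w a + 1) div 2)" if "a \<in> D" for a
  proof -
    define j where "j = (w a + 1) div 2"
    have "1 \<le> j" "w a \<le> 2 * j" using w[OF that] unfolding j_def by linarith+
    then have "(k - 1) * 1 \<le> (k - 1) * real_of_int j" "real_of_int (w a) \<le> 2 * real_of_int j"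
      using k by (intro mult_left_mono, simp_all)
    then show ?thesis unfolding j_def[symmetric] by (simp add: algebra_simps)
  qed
  have down: "real_of_int (w a) - 1 \<le> (k + 1) * real_of_int (w a div 2)" if "a \<in> D" for a
  proof -
    define j where "j = w a div 2"
    have "0 \<le> j" "w a \<le> 2 * j + 1" using w[OF that] unfolding j_def by linarith+
    then have "2 * real_of_int j \<le> (k + 1) * real_of_int j" "real_of_int (w a) \<le> 2 * real_of_int j + 1"
      using k by (intro mult_right_mono, simp_all)
    then show ?thesis unfolding j_def[symmetric] by simp
  qed
  \<comment> \<open>\<open>up\<close> gains \<open>k - 1\<close> on each arc of \<open>P\<close>,
    \<open>down\<close> loses 1 on each other arc; \<open>bal\<close> says that the gains pay for
    the losses.\<close>
  have "real_of_int (sum w D) \<le> real_of_int (sum w D) + ((k - 1) * card {a\<in>D. P a} - card {a\<in>D. \<not> P a})"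
    using bal by simp
  also have "\<dots> = (\<Sum>a\<in>D. real_of_int (w a) + (if P a then k - 1 else - 1))"
  proof -
    have "{a\<in>D. P a} = D \<inter> {a. P a}" "{a\<in>D. \<not> P a} = D \<inter> - {a. P a}" by auto
    then show ?thesis
      using \<open>finite D\<close> by (simp add: sum.distrib sum.If_cases mult.commute)
  qed
  also have "\<dots> \<le> (\<Sum>a\<in>D. (k + 1) * real_of_int (if P a then (w a + 1) div 2 else w a div 2))"
    by (rule sum_mono) (use up down in force)
  finally show ?thesis by (simp add: sum_distrib_left)
qed

text \<open>The two choices of \<open>P\<close> round up the forward or the backward arcs; the two
  inequalities of \<open>dout_balanced\<close> serve one choice each.\<close>

lemma rounded_halves_cover_cuts:
  fixes k :: real
  assumes G: "graph V E ea eb" and k: "2 \<le> k" and flow: "nz_circ_flow V E ea eb k ori f"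
    and scd: "nz_scd V E ea eb \<tau> w" and U: "U \<noteq> {}" "U \<subset> V"
    and P: "P = (\<lambda>a. snd a = ori (fst a)) \<or> P = (\<lambda>a. snd a \<noteq> ori (fst a))"
  shows "\<lfloor>\<tau> / (k + 1)\<rfloor> \<le> (\<Sum>a\<in>dout E ea eb U. if P a then (w a + 1) div 2 else w a div 2)"
    (is "_ \<le> ?S")
proof -
  have fin: "finite (dout E ea eb U)"
    using G by (simp add: graph_def dout_def arcs_def)
  have w: "1 \<le> w a" if "a \<in> dout E ea eb U" for a
    using that scd by (cases a; cases "snd a") (auto simp: nz_scd_def dout_def arcs_def)
  have "real_of_int (sum w (dout E ea eb U)) \<le> (k + 1) * ?S"
    by (rule rounded_halves_ge[OF fin k w])
      (use P dout_balanced[OF G flow] U in auto)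
  moreover have "\<tau> \<le> sum w (dout E ea eb U)"
    using scd U by (simp add: nz_scd_def)
  ultimately have "real_of_int \<tau> \<le> (k + 1) * real_of_int ?S"
    by linarith
  then have "\<tau> / (k + 1) \<le> real_of_int ?S"
    using k by (simp add: pos_divide_le_eq mult.commute del: of_int_sum)
  then show ?thesis by (simp add: floor_le_iff del: of_int_sum)
qed

section \<open>Packing strongly connected digraphs\<close>

theorem theorem9:
  fixes V :: "'v set" and E :: "'e set" and ea eb :: "'e \<Rightarrow> 'v"
    and k :: rat and \<tau> :: int and w :: "'e \<times> bool \<Rightarrow> int"
  assumes "graph V E ea eb"
    and "k \<ge> 2"
    and "has_nz_circ_flow V E ea eb (real_of_rat k)"
    and "\<tau> > 0"
    and "nz_scd V E ea eb \<tau> w"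
  shows "\<exists>F :: nat \<Rightarrow> ('e \<times> bool) set.
           (\<forall>i < nat \<lfloor>real_of_int \<tau> / (real_of_rat k + 1)\<rfloor>.
              F i \<subseteq> arcs E \<and>
              (\<forall>U. U \<noteq> {} \<and> U \<subset> V \<longrightarrow> dout E ea eb U \<inter> F i \<noteq> {})) \<and>
           (\<forall>a \<in> arcs E. int (card {i. i < nat \<lfloor>real_of_int \<tau> / (real_of_rat k + 1)\<rfloor> \<and> a \<in> F i}) \<le> w a)"
proof -
  have w: "1 \<le> w a" if "a \<in> arcs E" for a
    using that assms(5) by (cases a; cases "snd a") (auto simp: nz_scd_def arcs_def)
  show ?thesis
  proof (cases "V = {}")
    \<comment> \<open>There is no root to choose, but also no cut to cover, so empty arc sets
      suffice.\<close>
    case True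
    have "0 \<le> w a" if "a \<in> arcs E" for a
      using w[OF that] by simp
    with True show ?thesis
      by (intro exI[of _ "\<lambda>_. {}"]) simp
  next
    case False
    then obtain r where r: "r \<in> V" by auto
    define K where "K = real_of_rat k"
    define m where "m = nat \<lfloor>real_of_int \<tau> / (K + 1)\<rfloor>"
    have K: "2 \<le> K" using \<open>k \<ge> 2\<close> unfolding K_def
      by (metis of_rat_less_eq of_rat_numeral_eq)
    have m: "int m = \<lfloor>real_of_int \<tau> / (K + 1)\<rfloor>"
      using \<open>\<tau> > 0\<close> K by (simp add: m_def)
    obtain ori f where flow: "nz_circ_flow V E ea eb K ori f"
      using assms(3) by (auto simp: has_nz_circ_flow_def K_def)
    let ?t = "arc_tail ea eb" and ?h = "arc_head ea eb" and ?A = "arcs E"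
    have fin: "finite V" "finite ?A" and ends: "\<And>a. a \<in> ?A \<Longrightarrow> ?t a \<in> V \<and> ?h a \<in> V"
      using assms(1) by (auto simp: graph_def arcs_def arc_tail_def arc_head_def)
    define x where "x a = (if snd a = ori (fst a) then (w a + 1) div 2 else w a div 2)" for a
    define y where "y a = (if snd a \<noteq> ori (fst a) then (w a + 1) div 2 else w a div 2)" for a
    have xy: "x a + y a = w a" for a
      unfolding x_def y_def by (cases "snd a = ori (fst a)") (simp, presburger)+
    have nonneg: "0 \<le> x a" "0 \<le> y a" if "a \<in> ?A" for a
      using w[OF that] by (auto simp: x_def y_def)
    have cut: "int m \<le> sum x (dout E ea eb U)" "int m \<le> sum y (dout E ea eb U)"
      if "U \<noteq> {}" "U \<subset> V" for U
      unfolding m x_def y_def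
      using rounded_halves_cover_cuts[OF assms(1) K flow assms(5) that] by auto
    have compl: "entering ?A ?t ?h (V - U) = dout E ea eb U" if "U \<subseteq> V" for U
      using ends that by (auto simp: entering_def dout_def)
    \<comment> \<open>Since \<open>r\<close> lies in \<open>V - X\<close>, this complement is a
      proper nonempty set, and the arcs leaving it are those entering \<open>X\<close>.\<close>
    have xcut: "int m \<le> sum x (entering ?A ?t ?h X)" if X: "X \<subseteq> V - {r}" "X \<noteq> {}" for X
    proof -
      have "V - (V - X) = X" "V - X \<noteq> {}" "V - X \<subset> V" using X r by auto
      then show ?thesis using cut(1)[of "V - X"] compl[of "V - X"] by auto
    qed
    obtain A where
      A: "\<forall>i<m. A i \<subseteq> ?A \<and> (\<forall>X. X \<subseteq> V - {r} \<and> X \<noteq> {} \<longrightarrow> entering ?A ?t ?h X \<inter> A i \<noteq> {})"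
        "\<forall>a\<in>?A. int (card {i. i < m \<and> a \<in> A i}) \<le> x a"
      using edmonds_branchings[of V ?A r ?t ?h x m, OF fin r] ends nonneg(1) xcut by auto
    have ycut: "int m \<le> sum y (entering ?A ?h ?t X)" if X: "X \<subseteq> V - {r}" "X \<noteq> {}" for X
      using cut(2)[of X] X r by (auto simp: dout_conv_entering)
    \<comment> \<open>In-branchings towards \<open>r\<close>, obtained from Edmonds' theorem on the
      reversed arcs.\<close>
    obtain B where
      B: "\<forall>i<m. B i \<subseteq> ?A \<and> (\<forall>X. X \<subseteq> V - {r} \<and> X \<noteq> {} \<longrightarrow> dout E ea eb X \<inter> B i \<noteq> {})"
        "\<forall>a\<in>?A. int (card {i. i < m \<and> a \<in> B i}) \<le> y a"
      using edmonds_branchings[of V ?A r ?h ?t y m, OF fin r] ends nonneg(2) ycut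
      unfolding dout_conv_entering by auto
    \<comment> \<open>If \<open>r\<close> is in \<open>U\<close>, the out-branching
      \<open>A i\<close> must enter the complement; otherwise the in-branching \<open>B i\<close>
      must leave \<open>U\<close>.\<close>
    have strong: "dout E ea eb U \<inter> (A i \<union> B i) \<noteq> {}" if "i < m" "U \<noteq> {}" "U \<subset> V" for i U
    proof (cases "r \<in> U")
      case True
      then have "V - U \<subseteq> V - {r}" "V - U \<noteq> {}" using that by auto
      then have "entering ?A ?t ?h (V - U) \<inter> A i \<noteq> {}"
        using A(1) \<open>i < m\<close> by simp
      then show ?thesis using compl[of U] that by auto
    next
      case False
      then have "U \<subseteq> V - {r}" using that by auto
      then have "dout E ea eb U \<inter> B i \<noteq> {}"
        using B(1) that by simp
      then show ?thesis by auto
    qed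
    \<comment> \<open>\<open>A i\<close> and \<open>B i\<close> draw on the separate budgets
      \<open>x\<close> and \<open>y\<close>, so even an arc shared by them stays within
      \<open>x a + y a = w a\<close>.\<close>
    have packing: "int (card {i. i < m \<and> a \<in> A i \<union> B i}) \<le> w a" if "a \<in> ?A" for a
    proof -
      have "{i. i < m \<and> a \<in> A i \<union> B i} = {i. i < m \<and> a \<in> A i} \<union> {i. i < m \<and> a \<in> B i}" by auto
      then have "card {i. i < m \<and> a \<in> A i \<union> B i} \<le> card {i. i < m \<and> a \<in> A i} + card {i. i < m \<and> a \<in> B i}"
        by (simp only: card_Un_le)
      then show ?thesis using bspec[OF A(2) that] bspec[OF B(2) that] xy[of a] by linarith
    qed
    have sub: "A i \<union> B i \<subseteq> ?A" if "i < m" for i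
      using A(1) B(1) that by simp
    show ?thesis
      unfolding K_def[symmetric] m_def[symmetric]
      by (intro exI[of _ "\<lambda>i. A i \<union> B i"] conjI allI ballI impI; (elim conjE)?)
        (fact sub strong packing)+
  qed
qed

end
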